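(* Let $\mathbf{N}=\langle \mathbf{A},\blacksquare,\Diamond_N\rangle$ be a modal Nelson lattice. Then $\mathbf{N}$ is isomorphic to $\mathbf{N}(\mathbf{M}_\mathbf{N}^*,F^* )$, where $F^*=\{(a\vee\sim a)^2 : a\in A\}$. The isomorphism is $h\colon A\to R(\mathbf{H}^*,F^* )$, $h(a)=(a^2,(\sim a)^2)$.
   Context: A Nelson lattice is an involutive residuated lattice $\mathbf{A}=\langle A,\wedge,\vee,*,\Rightarrow,\top,\bot\rangle$ (with $\sim a=a\Rightarrow\bot$, $\sim\sim a=a$, $a^2=a*a$) satisfying $((a^2\Rightarrow b)\wedge((\sim b)^2\Rightarrow\sim a))\Rightarrow(a\Rightarrow b)=\top$. A modal Nelson lattice (MN-lattice) is $\mathbf{N}=\langle\mathbf{A},\blacksquare,\Diamond_N\rangle$ with $\mathbf{A}$ a Nelson lattice and $\blacksquare,\Diamond_N$ unary operators (here $\Diamond_N$ denotes the Nelson-level diamond, written as a black lozenge in the paper) such that for all $a,b$: (mN1) $\Diamond_N a=\sim\blacksquare\sim a$; (mN2) if $a^2=b^2$ then $(\blacksquare a)^2=(\blacksquare b)^2$ and $(\Diamond_N a)^2=(\Diamond_N b)^2$; (mN3) $(\blacksquare a\wedge\Diamond_N(\sim a^2\wedge b))^2=\bot$. For a Heyting algebra $\mathbf{H}$ (implication $\rightharpoonup$, $-a=a\rightharpoonup\bot$), a Boolean filter is a filter containing all dense elements ($a$ with $--a=\top$). A modal Heyting algebra is $\mathbf{M}=\langle\mathbf{H},\square,\Diamond\rangle$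 with $\mathbf{H}$ a Heyting algebra and unary $\square,\Diamond$ satisfying $\square a\wedge\Diamond(-a\wedge b)=\bot$ (equivalently: $a\wedge b=\bot$ implies $\square a\wedge\Diamond b=\bot$). For such $\mathbf{M}$ and a Boolean filter $F$ satisfying (F): if $a\wedge b=\bot$ and $a\vee b\in F$ then $\square a\vee\Diamond b\in F$, define $R(\mathbf{H},F)=\{(x,y)\in H\times H: x\wedge y=\bot,\ x\vee y\in F\}$ with $(x,y)\vee(s,t)=(x\vee s,y\wedge t)$, $(x,y)\wedge(s,t)=(x\wedge s,y\vee t)$, $(x,y)*(s,t)=(x\wedge s,(x\rightharpoonup t)\wedge(s\rightharpoonup y))$, $(x,y)\Rightarrow(s,t)=((x\rightharpoonup s)\wedge(t\rightharpoonup y),x\wedge t)$, $\top=(\top,\bot)$, $\bot=(\bot,\top)$, and modal operators $\blacksquare(x,y)=(\square x,\Diamond y)$, $\Diamond_N(x,y)=(\Diamond x,\square y)$; this is the MN-lattice $\mathbf{N}(\mathbf{M},F)$. Given an MN-lattice $\mathbf{N}$, $\mathbf{H}^*$ is the Heyting algebra on $H^*=\{a\in A: a^2=a\}$ with $a\vee^*b=(a\vee b)^2$, $a\wedge^*b=(a\wedge b)^2$, $a\rightharpoonup^*b=(a^2\Rightarrow b)^2$, constants $\bot,\top$; and $\mathbf{M}_\mathbf{N}^*=\langle\mathbf{H}^*,\square^*,\Diamond^*\rangle$ with $\square^*a=(\blacksquare a)^2$, $\Diamond^*a=(\Diamond_N a)^2$, which is a modal Heyting algebra. *)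

theory Defs
  imports "HOL-Algebra.Group"
begin

text \<open>
  Algebras are records with an explicit carrier, because the algebras built from a modal Nelson
  lattice live on proper subsets of a type.  Heyting algebras and Nelson lattices share the
  signature \<open>lat_alg\<close> of bounded lattices with an implication.
\<close>

record 'a lat_alg = "'a partial_object" +
  lmeet :: "'a \<Rightarrow> 'a \<Rightarrow> 'a"  (infixl "\<^bold>\<and>\<index>" 70)
  ljoin :: "'a \<Rightarrow> 'a \<Rightarrow> 'a"  (infixl "\<^bold>\<or>\<index>" 65)
  limp  :: "'a \<Rightarrow> 'a \<Rightarrow> 'a"  (infixr "\<^bold>\<rightarrow>\<index>" 60)
  ltop  :: 'a  ("\<^bold>\<top>\<index>")
  lbot  :: 'a  ("\<^bold>\<bottom>\<index>")

record 'a modal_lat_alg = "'a lat_alg" +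
  box :: "'a \<Rightarrow> 'a"
  dia :: "'a \<Rightarrow> 'a"

record 'a res_alg = "'a lat_alg" +
  lmult :: "'a \<Rightarrow> 'a \<Rightarrow> 'a"  (infixl "\<^bold>*\<index>" 70)

record 'a modal_res_alg = "'a res_alg" +
  nbox :: "'a \<Rightarrow> 'a"
  ndia :: "'a \<Rightarrow> 'a"

definition lle :: "('a, 'm) lat_alg_scheme \<Rightarrow> 'a \<Rightarrow> 'a \<Rightarrow> bool"  (infix "\<^bold>\<le>\<index>" 50)
  where "x \<^bold>\<le>\<^bsub>L\<^esub> y \<longleftrightarrow> x \<^bold>\<and>\<^bsub>L\<^esub> y = x"

text \<open>Read as \<open>-x\<close> in a Heyting algebra and as \<open>\<sim>x\<close> in a residuated lattice.\<close>

definition lneg :: "('a, 'm) lat_alg_scheme \<Rightarrow> 'a \<Rightarrow> 'a"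
  where "lneg L x = x \<^bold>\<rightarrow>\<^bsub>L\<^esub> \<^bold>\<bottom>\<^bsub>L\<^esub>"

definition sq :: "('a, 'm) res_alg_scheme \<Rightarrow> 'a \<Rightarrow> 'a"
  where "sq A x = x \<^bold>*\<^bsub>A\<^esub> x"

locale bdd_lattice =
  fixes L (structure)
  assumes meet_closed: "\<lbrakk>x \<in> carrier L; y \<in> carrier L\<rbrakk> \<Longrightarrow> x \<^bold>\<and> y \<in> carrier L"
    and join_closed: "\<lbrakk>x \<in> carrier L; y \<in> carrier L\<rbrakk> \<Longrightarrow> x \<^bold>\<or> y \<in> carrier L"
    and imp_closed: "\<lbrakk>x \<in> carrier L; y \<in> carrier L\<rbrakk> \<Longrightarrow> x \<^bold>\<rightarrow> y \<in> carrier L"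
    and top_closed: "\<^bold>\<top> \<in> carrier L"
    and bot_closed: "\<^bold>\<bottom> \<in> carrier L"
    and meet_comm: "\<lbrakk>x \<in> carrier L; y \<in> carrier L\<rbrakk> \<Longrightarrow> x \<^bold>\<and> y = y \<^bold>\<and> x"
    and join_comm: "\<lbrakk>x \<in> carrier L; y \<in> carrier L\<rbrakk> \<Longrightarrow> x \<^bold>\<or> y = y \<^bold>\<or> x"
    and meet_assoc: "\<lbrakk>x \<in> carrier L; y \<in> carrier L; z \<in> carrier L\<rbrakk>
          \<Longrightarrow> (x \<^bold>\<and> y) \<^bold>\<and> z = x \<^bold>\<and> (y \<^bold>\<and> z)"
    and join_assoc: "\<lbrakk>x \<in> carrier L; y \<in> carrier L; z \<in> carrier L\<rbrakk>
          \<Longrightarrow> (x \<^bold>\<or> y) \<^bold>\<or> z = x \<^bold>\<or> (y \<^bold>\<or> z)"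
    and meet_join_absorb: "\<lbrakk>x \<in> carrier L; y \<in> carrier L\<rbrakk> \<Longrightarrow> x \<^bold>\<and> (x \<^bold>\<or> y) = x"
    and join_meet_absorb: "\<lbrakk>x \<in> carrier L; y \<in> carrier L\<rbrakk> \<Longrightarrow> x \<^bold>\<or> (x \<^bold>\<and> y) = x"
    and bot_least: "x \<in> carrier L \<Longrightarrow> \<^bold>\<bottom> \<^bold>\<le> x"
    and top_greatest: "x \<in> carrier L \<Longrightarrow> x \<^bold>\<le> \<^bold>\<top>"

locale heyting_algebra = bdd_lattice H for H (structure) +
  assumes heyting_imp: "\<lbrakk>x \<in> carrier H; y \<in> carrier H; z \<in> carrier H\<rbrakk>
          \<Longrightarrow> x \<^bold>\<and> y \<^bold>\<le> z \<longleftrightarrow> x \<^bold>\<le> y \<^bold>\<rightarrow> z"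

locale modal_heyting_algebra = heyting_algebra M for M (structure) +
  assumes box_closed: "x \<in> carrier M \<Longrightarrow> box M x \<in> carrier M"
    and dia_closed: "x \<in> carrier M \<Longrightarrow> dia M x \<in> carrier M"
    and box_dia: "\<lbrakk>x \<in> carrier M; y \<in> carrier M\<rbrakk>
          \<Longrightarrow> box M x \<^bold>\<and> dia M (lneg M x \<^bold>\<and> y) = \<^bold>\<bottom>"

text \<open>
  Residuated lattices are bounded, commutative and integral: the unit of the monoid is the
  greatest element.
\<close>

locale residuated_lattice = bdd_lattice A for A (structure) +
  assumes mult_comm_monoid: "comm_monoid \<lparr>carrier = carrier A, mult = lmult A, one = ltop A\<rparr>"
    and residuation: "\<lbrakk>x \<in> carrier A; y \<in> carrier A; z \<in> carrier A\<rbrakk>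
          \<Longrightarrow> x \<^bold>* y \<^bold>\<le> z \<longleftrightarrow> x \<^bold>\<le> y \<^bold>\<rightarrow> z"

locale nelson_lattice = residuated_lattice A for A (structure) +
  assumes involutive: "x \<in> carrier A \<Longrightarrow> lneg A (lneg A x) = x"
    and nelson: "\<lbrakk>x \<in> carrier A; y \<in> carrier A\<rbrakk>
          \<Longrightarrow> ((sq A x \<^bold>\<rightarrow> y) \<^bold>\<and> (sq A (lneg A y) \<^bold>\<rightarrow> lneg A x)) \<^bold>\<rightarrow> (x \<^bold>\<rightarrow> y) = \<^bold>\<top>"

locale mn_lattice = nelson_lattice N for N (structure) +
  assumes nbox_closed: "x \<in> carrier N \<Longrightarrow> nbox N x \<in> carrier N"
    and ndia_closed: "x \<in> carrier N \<Longrightarrow> ndia N x \<in> carrier N"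
    and mN1: "x \<in> carrier N \<Longrightarrow> ndia N x = lneg N (nbox N (lneg N x))"
    and mN2_box: "\<lbrakk>x \<in> carrier N; y \<in> carrier N; sq N x = sq N y\<rbrakk>
          \<Longrightarrow> sq N (nbox N x) = sq N (nbox N y)"
    and mN2_dia: "\<lbrakk>x \<in> carrier N; y \<in> carrier N; sq N x = sq N y\<rbrakk>
          \<Longrightarrow> sq N (ndia N x) = sq N (ndia N y)"
    and mN3: "\<lbrakk>x \<in> carrier N; y \<in> carrier N\<rbrakk>
          \<Longrightarrow> sq N (nbox N x \<^bold>\<and> ndia N (lneg N (sq N x) \<^bold>\<and> y)) = \<^bold>\<bottom>"

text \<open>Filters are nonempty but need not be proper.\<close>

definition lfilter :: "('a, 'm) lat_alg_scheme \<Rightarrow> 'a set \<Rightarrow> bool"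
  where "lfilter L F \<longleftrightarrow> F \<subseteq> carrier L \<and> F \<noteq> {}
    \<and> (\<forall>x\<in>F. \<forall>y\<in>F. x \<^bold>\<and>\<^bsub>L\<^esub> y \<in> F)
    \<and> (\<forall>x\<in>F. \<forall>y\<in>carrier L. x \<^bold>\<le>\<^bsub>L\<^esub> y \<longrightarrow> y \<in> F)"

definition boolean_filter :: "('a, 'm) lat_alg_scheme \<Rightarrow> 'a set \<Rightarrow> bool"
  where "boolean_filter H F \<longleftrightarrow> lfilter H F
    \<and> (\<forall>x\<in>carrier H. lneg H (lneg H x) = \<^bold>\<top>\<^bsub>H\<^esub> \<longrightarrow> x \<in> F)"

definition modal_filter_cond :: "('a, 'm) modal_lat_alg_scheme \<Rightarrow> 'a set \<Rightarrow> bool"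
  where "modal_filter_cond M F \<longleftrightarrow> (\<forall>x\<in>carrier M. \<forall>y\<in>carrier M.
    x \<^bold>\<and>\<^bsub>M\<^esub> y = \<^bold>\<bottom>\<^bsub>M\<^esub> \<and> x \<^bold>\<or>\<^bsub>M\<^esub> y \<in> F \<longrightarrow> box M x \<^bold>\<or>\<^bsub>M\<^esub> dia M y \<in> F)"

definition twist_carrier :: "('a, 'm) lat_alg_scheme \<Rightarrow> 'a set \<Rightarrow> ('a \<times> 'a) set"
  where "twist_carrier H F =
    {(x, y). x \<in> carrier H \<and> y \<in> carrier H \<and> x \<^bold>\<and>\<^bsub>H\<^esub> y = \<^bold>\<bottom>\<^bsub>H\<^esub> \<and> x \<^bold>\<or>\<^bsub>H\<^esub> y \<in> F}"

definition twist_mn :: "('a, 'm) modal_lat_alg_scheme \<Rightarrow> 'a set \<Rightarrow> ('a \<times> 'a) modal_res_alg"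
  where "twist_mn M F =
    \<lparr>carrier = twist_carrier M F,
     lmeet = (\<lambda>(x, y) (s, t). (x \<^bold>\<and>\<^bsub>M\<^esub> s, y \<^bold>\<or>\<^bsub>M\<^esub> t)),
     ljoin = (\<lambda>(x, y) (s, t). (x \<^bold>\<or>\<^bsub>M\<^esub> s, y \<^bold>\<and>\<^bsub>M\<^esub> t)),
     limp = (\<lambda>(x, y) (s, t). ((x \<^bold>\<rightarrow>\<^bsub>M\<^esub> s) \<^bold>\<and>\<^bsub>M\<^esub> (t \<^bold>\<rightarrow>\<^bsub>M\<^esub> y), x \<^bold>\<and>\<^bsub>M\<^esub> t)),
     ltop = (\<^bold>\<top>\<^bsub>M\<^esub>, \<^bold>\<bottom>\<^bsub>M\<^esub>),
     lbot = (\<^bold>\<bottom>\<^bsub>M\<^esub>, \<^bold>\<top>\<^bsub>M\<^esub>),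
     lmult = (\<lambda>(x, y) (s, t). (x \<^bold>\<and>\<^bsub>M\<^esub> s, (x \<^bold>\<rightarrow>\<^bsub>M\<^esub> t) \<^bold>\<and>\<^bsub>M\<^esub> (s \<^bold>\<rightarrow>\<^bsub>M\<^esub> y))),
     nbox = (\<lambda>(x, y). (box M x, dia M y)),
     ndia = (\<lambda>(x, y). (dia M x, box M y))\<rparr>"

definition star_mh :: "('a, 'm) modal_res_alg_scheme \<Rightarrow> 'a modal_lat_alg"
  where "star_mh N =
    \<lparr>carrier = {a \<in> carrier N. sq N a = a},
     lmeet = (\<lambda>a b. sq N (a \<^bold>\<and>\<^bsub>N\<^esub> b)),
     ljoin = (\<lambda>a b. sq N (a \<^bold>\<or>\<^bsub>N\<^esub> b)),
     limp = (\<lambda>a b. sq N (sq N a \<^bold>\<rightarrow>\<^bsub>N\<^esub> b)),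
     ltop = \<^bold>\<top>\<^bsub>N\<^esub>,
     lbot = \<^bold>\<bottom>\<^bsub>N\<^esub>,
     box = (\<lambda>a. sq N (nbox N a)),
     dia = (\<lambda>a. sq N (ndia N a))\<rparr>"

definition star_filter :: "('a, 'm) res_alg_scheme \<Rightarrow> 'a set"
  where "star_filter A = (\<lambda>a. sq A (a \<^bold>\<or>\<^bsub>A\<^esub> lneg A a)) ` carrier A"

definition mn_hom ::
    "('a, 'm) modal_res_alg_scheme \<Rightarrow> ('b, 'n) modal_res_alg_scheme \<Rightarrow> ('a \<Rightarrow> 'b) set"
  where "mn_hom N N' = {h. h ` carrier N \<subseteq> carrier N'
    \<and> h \<^bold>\<top>\<^bsub>N\<^esub> = \<^bold>\<top>\<^bsub>N'\<^esub> \<and> h \<^bold>\<bottom>\<^bsub>N\<^esub> = \<^bold>\<bottom>\<^bsub>N'\<^esub>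
    \<and> (\<forall>a\<in>carrier N. h (nbox N a) = nbox N' (h a) \<and> h (ndia N a) = ndia N' (h a))
    \<and> (\<forall>a\<in>carrier N. \<forall>b\<in>carrier N.
         h (a \<^bold>\<and>\<^bsub>N\<^esub> b) = h a \<^bold>\<and>\<^bsub>N'\<^esub> h b \<and> h (a \<^bold>\<or>\<^bsub>N\<^esub> b) = h a \<^bold>\<or>\<^bsub>N'\<^esub> h b
       \<and> h (a \<^bold>*\<^bsub>N\<^esub> b) = h a \<^bold>*\<^bsub>N'\<^esub> h b \<and> h (a \<^bold>\<rightarrow>\<^bsub>N\<^esub> b) = h a \<^bold>\<rightarrow>\<^bsub>N'\<^esub> h b)}"

definition mn_iso ::
    "('a, 'm) modal_res_alg_scheme \<Rightarrow> ('b, 'n) modal_res_alg_scheme \<Rightarrow> ('a \<Rightarrow> 'b) set"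
  where "mn_iso N N' = {h \<in> mn_hom N N'. bij_betw h (carrier N) (carrier N')}"

end

theory Submission
  imports Defs
begin

text \<open>
  The Nelson identity says that \<open>x\<^sup>2 \<le> y\<close> and \<open>(\<sim>y)\<^sup>2 \<le> \<sim>x\<close> imply \<open>x \<le> y\<close>; this makes \<open>h\<close>
  injective and forces \<open>x * x\<^sup>2 = x\<^sup>2\<close>.  Hence squares are idempotent, \<open>(x \<and> y)\<^sup>2 = x\<^sup>2 * y\<^sup>2\<close>
  and \<open>(x \<or> y)\<^sup>2 = x\<^sup>2 \<or> y\<^sup>2\<close>, so that on \<open>H\<^sup>*\<close> the meet is the monoid product and the join is
  the original one.  An element \<open>f\<close> lies in \<open>F\<^sup>*\<close> iff \<open>f = c\<^sup>2\<close> for some \<open>c\<close> with \<open>(\<sim>c)\<^sup>2 = \<bottom>\<close>.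
  If \<open>x * y = \<bottom>\<close> and \<open>x \<or> y = c\<^sup>2\<close> for such a \<open>c\<close>, then \<open>h (\<sim>y \<and> c) = (x, y)\<close>, so \<open>h\<close> is onto.
\<close>

section \<open>Order facts in bounded lattices\<close>

context bdd_lattice
begin

lemmas lattice_closed [simp, intro] = meet_closed join_closed imp_closed top_closed bot_closed

lemma meet_idem: "x \<in> carrier L \<Longrightarrow> x \<^bold>\<and> x = x"
  by (metis meet_join_absorb join_meet_absorb meet_closed)

lemma le_refl [simp]: "x \<in> carrier L \<Longrightarrow> x \<^bold>\<le> x"
  by (simp add: lle_def meet_idem)

lemma le_antisym: "\<lbrakk>x \<^bold>\<le> y; y \<^bold>\<le> x; x \<in> carrier L; y \<in> carrier L\<rbrakk> \<Longrightarrow> x = y"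
  by (metis lle_def meet_comm)

lemma le_trans:
  "\<lbrakk>x \<^bold>\<le> y; y \<^bold>\<le> z; x \<in> carrier L; y \<in> carrier L; z \<in> carrier L\<rbrakk> \<Longrightarrow> x \<^bold>\<le> z"
  by (metis lle_def meet_assoc)

lemma meet_le1 [simp]: "\<lbrakk>x \<in> carrier L; y \<in> carrier L\<rbrakk> \<Longrightarrow> x \<^bold>\<and> y \<^bold>\<le> x"
  by (metis lle_def meet_assoc meet_comm meet_idem meet_closed)

lemma meet_le2 [simp]: "\<lbrakk>x \<in> carrier L; y \<in> carrier L\<rbrakk> \<Longrightarrow> x \<^bold>\<and> y \<^bold>\<le> y"
  by (metis meet_le1 meet_comm)

lemma le_meet:
  "\<lbrakk>z \<^bold>\<le> x; z \<^bold>\<le> y; x \<in> carrier L; y \<in> carrier L; z \<in> carrier L\<rbrakk> \<Longrightarrow> z \<^bold>\<le> x \<^bold>\<and> y"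
  by (metis lle_def meet_assoc)

lemma le_iff_join: "\<lbrakk>x \<in> carrier L; y \<in> carrier L\<rbrakk> \<Longrightarrow> x \<^bold>\<le> y \<longleftrightarrow> x \<^bold>\<or> y = y"
  by (metis lle_def meet_join_absorb join_meet_absorb meet_comm join_comm)

lemma le_join1 [simp]: "\<lbrakk>x \<in> carrier L; y \<in> carrier L\<rbrakk> \<Longrightarrow> x \<^bold>\<le> x \<^bold>\<or> y"
  by (simp add: lle_def meet_join_absorb)

lemma le_join2 [simp]: "\<lbrakk>x \<in> carrier L; y \<in> carrier L\<rbrakk> \<Longrightarrow> y \<^bold>\<le> x \<^bold>\<or> y"
  by (metis le_join1 join_comm)

lemma join_le:
  "\<lbrakk>x \<^bold>\<le> z; y \<^bold>\<le> z; x \<in> carrier L; y \<in> carrier L; z \<in> carrier L\<rbrakk> \<Longrightarrow> x \<^bold>\<or> y \<^bold>\<le> z"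
  by (metis le_iff_join join_assoc join_closed)

lemma lneg_closed [simp, intro]: "x \<in> carrier L \<Longrightarrow> lneg L x \<in> carrier L"
  by (simp add: lneg_def)

end

section \<open>Arithmetic of integral commutative residuated lattices and their idempotents\<close>

context residuated_lattice
begin

lemma mult_closed [simp, intro]: "\<lbrakk>x \<in> carrier A; y \<in> carrier A\<rbrakk> \<Longrightarrow> x \<^bold>* y \<in> carrier A"
  using monoid.m_closed[OF comm_monoid.axioms(1)[OF mult_comm_monoid]] by simp

lemma mult_assoc: "\<lbrakk>x \<in> carrier A; y \<in> carrier A; z \<in> carrier A\<rbrakk>
    \<Longrightarrow> (x \<^bold>* y) \<^bold>* z = x \<^bold>* (y \<^bold>* z)"
  using monoid.m_assoc[OF comm_monoid.axioms(1)[OF mult_comm_monoid]] by simp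

lemma mult_comm: "\<lbrakk>x \<in> carrier A; y \<in> carrier A\<rbrakk> \<Longrightarrow> x \<^bold>* y = y \<^bold>* x"
  using comm_monoid.m_comm[OF mult_comm_monoid] by simp

lemma mult_left_comm: "\<lbrakk>x \<in> carrier A; y \<in> carrier A; z \<in> carrier A\<rbrakk>
    \<Longrightarrow> x \<^bold>* (y \<^bold>* z) = y \<^bold>* (x \<^bold>* z)"
  by (metis mult_assoc mult_comm)

lemmas mult_ac = mult_assoc mult_comm mult_left_comm

lemma mult_top [simp]: "x \<in> carrier A \<Longrightarrow> x \<^bold>* \<^bold>\<top> = x"
  using monoid.r_one[OF comm_monoid.axioms(1)[OF mult_comm_monoid]] by simp

lemma top_mult [simp]: "x \<in> carrier A \<Longrightarrow> \<^bold>\<top> \<^bold>* x = x"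
  by (metis mult_top mult_comm top_closed)

lemma sq_closed [simp, intro]: "x \<in> carrier A \<Longrightarrow> sq A x \<in> carrier A"
  by (simp add: sq_def)

lemma mult_mono1: "\<lbrakk>x \<^bold>\<le> y; x \<in> carrier A; y \<in> carrier A; z \<in> carrier A\<rbrakk>
    \<Longrightarrow> x \<^bold>* z \<^bold>\<le> y \<^bold>* z"
  by (meson residuation le_refl le_trans mult_closed imp_closed)

lemma mult_mono: "\<lbrakk>x \<^bold>\<le> y; u \<^bold>\<le> v; x \<in> carrier A; y \<in> carrier A; u \<in> carrier A; v \<in> carrier A\<rbrakk>
    \<Longrightarrow> x \<^bold>* u \<^bold>\<le> y \<^bold>* v"
  by (metis mult_mono1 mult_comm le_trans mult_closed)

lemma sq_mono: "\<lbrakk>x \<^bold>\<le> y; x \<in> carrier A; y \<in> carrier A\<rbrakk> \<Longrightarrow> sq A x \<^bold>\<le> sq A y"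
  by (simp add: sq_def mult_mono)

lemma mult_le1 [simp]: "\<lbrakk>x \<in> carrier A; y \<in> carrier A\<rbrakk> \<Longrightarrow> x \<^bold>* y \<^bold>\<le> x"
  by (metis mult_mono le_refl top_greatest mult_top top_closed)

lemma mult_le2 [simp]: "\<lbrakk>x \<in> carrier A; y \<in> carrier A\<rbrakk> \<Longrightarrow> x \<^bold>* y \<^bold>\<le> y"
  by (metis mult_le1 mult_comm)

lemma sq_le [simp]: "x \<in> carrier A \<Longrightarrow> sq A x \<^bold>\<le> x"
  by (simp add: sq_def)

lemma le_bot_iff: "x \<in> carrier A \<Longrightarrow> x \<^bold>\<le> \<^bold>\<bottom> \<longleftrightarrow> x = \<^bold>\<bottom>"
  by (metis le_antisym bot_least bot_closed le_refl)

lemma top_le_iff: "x \<in> carrier A \<Longrightarrow> \<^bold>\<top> \<^bold>\<le> x \<longleftrightarrow> x = \<^bold>\<top>"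
  by (metis le_antisym top_greatest top_closed le_refl)

lemma mult_bot [simp]: "x \<in> carrier A \<Longrightarrow> x \<^bold>* \<^bold>\<bottom> = \<^bold>\<bottom>"
  by (metis le_bot_iff mult_le2 mult_closed bot_closed)

lemma bot_mult [simp]: "x \<in> carrier A \<Longrightarrow> \<^bold>\<bottom> \<^bold>* x = \<^bold>\<bottom>"
  by (metis mult_bot mult_comm bot_closed)

lemma sq_bot [simp]: "sq A \<^bold>\<bottom> = \<^bold>\<bottom>" and sq_top [simp]: "sq A \<^bold>\<top> = \<^bold>\<top>"
  by (simp_all add: sq_def)

lemma join_bot [simp]: "x \<in> carrier A \<Longrightarrow> x \<^bold>\<or> \<^bold>\<bottom> = x"
  by (metis bot_closed bot_least join_comm le_iff_join)

lemma imp_eq_top_iff: "\<lbrakk>x \<in> carrier A; y \<in> carrier A\<rbrakk> \<Longrightarrow> x \<^bold>\<rightarrow> y = \<^bold>\<top> \<longleftrightarrow> x \<^bold>\<le> y"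
  by (metis residuation top_le_iff top_mult top_closed imp_closed)

lemma imp_mult_le: "\<lbrakk>x \<in> carrier A; y \<in> carrier A\<rbrakk> \<Longrightarrow> (x \<^bold>\<rightarrow> y) \<^bold>* x \<^bold>\<le> y"
  by (meson residuation le_refl imp_closed)

lemma le_imp_trans: "\<lbrakk>x \<^bold>\<le> y \<^bold>\<rightarrow> u; u \<^bold>\<le> v; x \<in> carrier A; y \<in> carrier A; u \<in> carrier A; v \<in> carrier A\<rbrakk>
    \<Longrightarrow> x \<^bold>\<le> y \<^bold>\<rightarrow> v"
  by (meson residuation le_trans mult_closed)

text \<open>By residuation, multiplication by \<open>x\<close> is a left adjoint and therefore
  preserves joins.\<close>

lemma mult_join_distrib:
  assumes "x \<in> carrier A" "y \<in> carrier A" "z \<in> carrier A"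
  shows "x \<^bold>* (y \<^bold>\<or> z) = x \<^bold>* y \<^bold>\<or> x \<^bold>* z"
proof (rule le_antisym)
  have "y \<^bold>\<le> x \<^bold>\<rightarrow> (x \<^bold>* y \<^bold>\<or> x \<^bold>* z)" "z \<^bold>\<le> x \<^bold>\<rightarrow> (x \<^bold>* y \<^bold>\<or> x \<^bold>* z)"
    using assms by (simp_all add: residuation[symmetric] mult_comm[of _ x])
  then have "(y \<^bold>\<or> z) \<^bold>* x \<^bold>\<le> x \<^bold>* y \<^bold>\<or> x \<^bold>* z"
    using assms by (simp add: residuation join_le)
  then show "x \<^bold>* (y \<^bold>\<or> z) \<^bold>\<le> x \<^bold>* y \<^bold>\<or> x \<^bold>* z"
    using assms by (simp add: mult_comm)
  show "x \<^bold>* y \<^bold>\<or> x \<^bold>* z \<^bold>\<le> x \<^bold>* (y \<^bold>\<or> z)"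
    using assms by (simp add: join_le mult_mono)
qed (use assms in auto)

lemma join_mult_distrib:
  "\<lbrakk>x \<in> carrier A; y \<in> carrier A; z \<in> carrier A\<rbrakk> \<Longrightarrow> (y \<^bold>\<or> z) \<^bold>* x = y \<^bold>* x \<^bold>\<or> z \<^bold>* x"
  by (metis mult_join_distrib mult_comm join_closed)

text \<open>Residuation with target \<bottom>. It translates disjointness for the product into an
  inequality.\<close>

lemma mult_eq_bot_iff: "\<lbrakk>x \<in> carrier A; y \<in> carrier A\<rbrakk> \<Longrightarrow> x \<^bold>* y = \<^bold>\<bottom> \<longleftrightarrow> x \<^bold>\<le> lneg A y"
  by (metis lneg_def residuation le_bot_iff bot_closed mult_closed)

lemma mult_lneg: "x \<in> carrier A \<Longrightarrow> x \<^bold>* lneg A x = \<^bold>\<bottom>"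
  by (metis mult_eq_bot_iff le_refl lneg_closed mult_comm)

lemma sq_mult: "\<lbrakk>x \<in> carrier A; y \<in> carrier A\<rbrakk> \<Longrightarrow> sq A (x \<^bold>* y) = sq A x \<^bold>* sq A y"
  by (simp add: sq_def mult_ac)

lemma sq_meet_lneg: "x \<in> carrier A \<Longrightarrow> sq A (x \<^bold>\<and> lneg A x) = \<^bold>\<bottom>"
  unfolding sq_def
  by (metis mult_mono meet_le1 meet_le2 mult_lneg le_bot_iff meet_closed mult_closed lneg_closed)

text \<open>Since \<open>x = x * x\<close>, monotonicity suffices. Seen from idempotents, the
  product thus behaves like a meet.\<close>

lemma idem_le_mult: "\<lbrakk>sq A x = x; x \<^bold>\<le> y; x \<^bold>\<le> z; x \<in> carrier A; y \<in> carrier A; z \<in> carrier A\<rbrakk>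
    \<Longrightarrow> x \<^bold>\<le> y \<^bold>* z"
  by (metis sq_def mult_mono)

lemma idem_le_sq: "\<lbrakk>sq A x = x; x \<^bold>\<le> y; x \<in> carrier A; y \<in> carrier A\<rbrakk> \<Longrightarrow> x \<^bold>\<le> sq A y"
  by (metis sq_mono)

lemma idem_mult_eq_iff: "\<lbrakk>sq A x = x; x \<in> carrier A; y \<in> carrier A\<rbrakk> \<Longrightarrow> x \<^bold>* y = x \<longleftrightarrow> x \<^bold>\<le> y"
  by (metis idem_le_mult le_refl le_antisym mult_le1 mult_le2 mult_closed)

end

section \<open>Consequences of the Nelson identity\<close>

context nelson_lattice
begin

lemma nelson_imp_le:
  assumes "x \<in> carrier A" "y \<in> carrier A"
  shows "(sq A x \<^bold>\<rightarrow> y) \<^bold>\<and> (sq A (lneg A y) \<^bold>\<rightarrow> lneg A x) \<^bold>\<le> x \<^bold>\<rightarrow> y"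
  using nelson[of x y] assms by (simp add: imp_eq_top_iff)

lemma nelson_le:
  assumes "sq A x \<^bold>\<le> y" "sq A (lneg A y) \<^bold>\<le> lneg A x" "x \<in> carrier A" "y \<in> carrier A"
  shows "x \<^bold>\<le> y"
proof -
  have "\<^bold>\<top> \<^bold>\<le> x \<^bold>\<rightarrow> y"
    using nelson_imp_le[of x y] assms by (simp add: imp_eq_top_iff[THEN iffD2] meet_idem)
  then show ?thesis
    using assms by (simp add: top_le_iff imp_eq_top_iff)
qed

lemma lneg_antimono_iff:
  "\<lbrakk>x \<in> carrier A; y \<in> carrier A\<rbrakk> \<Longrightarrow> lneg A x \<^bold>\<le> lneg A y \<longleftrightarrow> y \<^bold>\<le> x"
  by (metis mult_eq_bot_iff mult_comm involutive lneg_closed)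

lemma lneg_bot [simp]: "lneg A \<^bold>\<bottom> = \<^bold>\<top>"
  by (simp add: lneg_def imp_eq_top_iff)

lemma lneg_top [simp]: "lneg A \<^bold>\<top> = \<^bold>\<bottom>"
  by (metis involutive lneg_bot bot_closed)

text \<open>An order-reversing involution exchanges joins and meets.\<close>

lemma lneg_join:
  assumes "x \<in> carrier A" "y \<in> carrier A"
  shows "lneg A (x \<^bold>\<or> y) = lneg A x \<^bold>\<and> lneg A y"
proof (rule le_antisym)
  show "lneg A (x \<^bold>\<or> y) \<^bold>\<le> lneg A x \<^bold>\<and> lneg A y"
    using assms by (simp add: le_meet lneg_antimono_iff)
  have "x \<^bold>\<le> lneg A (lneg A x \<^bold>\<and> lneg A y)" "y \<^bold>\<le> lneg A (lneg A x \<^bold>\<and> lneg A y)"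
    using assms by (metis involutive lneg_antimono_iff meet_le1 meet_le2 meet_closed lneg_closed)+
  then have "x \<^bold>\<or> y \<^bold>\<le> lneg A (lneg A x \<^bold>\<and> lneg A y)"
    using assms by (simp add: join_le)
  then show "lneg A x \<^bold>\<and> lneg A y \<^bold>\<le> lneg A (x \<^bold>\<or> y)"
    using assms by (metis involutive lneg_antimono_iff meet_closed join_closed lneg_closed)
qed (use assms in auto)

lemma lneg_meet:
  "\<lbrakk>x \<in> carrier A; y \<in> carrier A\<rbrakk> \<Longrightarrow> lneg A (x \<^bold>\<and> y) = lneg A x \<^bold>\<or> lneg A y"
  by (metis lneg_join involutive lneg_closed join_closed)

text \<open>By residuation both sides are the largest \<open>z\<close> with \<open>z * x * y\<close>
  equal to \<bottom>.\<close>

lemma lneg_mult: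
  assumes "x \<in> carrier A" "y \<in> carrier A"
  shows "lneg A (x \<^bold>* y) = x \<^bold>\<rightarrow> lneg A y"
proof (rule le_antisym)
  have "lneg A (x \<^bold>* y) \<^bold>* x \<^bold>* y = \<^bold>\<bottom>"
    using assms by (metis mult_lneg mult_comm mult_assoc mult_closed lneg_closed)
  then show "lneg A (x \<^bold>* y) \<^bold>\<le> x \<^bold>\<rightarrow> lneg A y"
    using assms by (simp add: residuation[symmetric] mult_eq_bot_iff)
  have "(x \<^bold>\<rightarrow> lneg A y) \<^bold>* x \<^bold>* y = \<^bold>\<bottom>"
    using assms by (simp add: mult_eq_bot_iff imp_mult_le)
  then show "x \<^bold>\<rightarrow> lneg A y \<^bold>\<le> lneg A (x \<^bold>* y)"
    using assms by (simp add: mult_eq_bot_iff[symmetric] mult_assoc)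
qed (use assms in auto)

lemma lneg_imp: "\<lbrakk>x \<in> carrier A; y \<in> carrier A\<rbrakk> \<Longrightarrow> lneg A (x \<^bold>\<rightarrow> y) = x \<^bold>* lneg A y"
  by (metis lneg_mult involutive lneg_closed mult_closed)

lemma contraposition:
  "\<lbrakk>x \<in> carrier A; y \<in> carrier A\<rbrakk> \<Longrightarrow> lneg A y \<^bold>\<rightarrow> lneg A x = x \<^bold>\<rightarrow> y"
  by (metis lneg_mult mult_comm involutive lneg_closed)

text \<open>The Nelson identity is applied to \<open>x\<close> and \<open>?b\<close>: its conclusion
  \<open>x \<le> ?b\<close> unfolds by residuation to \<open>x * x \<le> ?c\<close>, which is the
  nontrivial inequality.\<close>

lemma mult_sq_self:
  assumes x: "x \<in> carrier A"
  shows "x \<^bold>* sq A x = sq A x"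
proof (rule le_antisym)
  let ?c = "x \<^bold>* sq A x" and ?b = "x \<^bold>\<rightarrow> x \<^bold>* sq A x"
  have "lneg A ?b = x \<^bold>* lneg A ?c"
    using x by (simp add: lneg_imp)
  \<comment> \<open>The square of \<open>x * lneg A ?c\<close> contributes two factors
    \<open>x\<close>; the extra \<open>x\<close> completes them to \<open>?c\<close>, which one of
    the factors \<open>lneg A ?c\<close> annihilates.\<close>
  then have "sq A (lneg A ?b) \<^bold>* x = (?c \<^bold>* lneg A ?c) \<^bold>* lneg A ?c"
    using x by (simp add: sq_def mult_ac)
  also have "\<dots> = \<^bold>\<bottom>"
    using x by (simp add: mult_lneg)
  finally have "sq A (lneg A ?b) \<^bold>\<le> lneg A x"
    using x by (simp add: mult_eq_bot_iff)
  moreover have "sq A x \<^bold>\<le> ?b"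
    using x by (simp add: residuation[symmetric] mult_comm)
  ultimately have "x \<^bold>\<le> ?b"
    using x by (simp add: nelson_le)
  then show "sq A x \<^bold>\<le> ?c"
    using x by (simp add: residuation[symmetric] sq_def)
qed (use x in auto)

lemma sq_sq [simp]: "x \<in> carrier A \<Longrightarrow> sq A (sq A x) = sq A x"
  by (metis mult_sq_self mult_assoc sq_def sq_closed)

lemma sq_meet:
  assumes "x \<in> carrier A" "y \<in> carrier A"
  shows "sq A (x \<^bold>\<and> y) = sq A x \<^bold>* sq A y"
proof (rule le_antisym)
  show "sq A (x \<^bold>\<and> y) \<^bold>\<le> sq A x \<^bold>* sq A y"
    using assms by (simp add: idem_le_mult sq_mono)
  show "sq A x \<^bold>* sq A y \<^bold>\<le> sq A (x \<^bold>\<and> y)"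
    using assms by (simp add: sq_mult[symmetric] sq_mono le_meet)
qed (use assms in auto)

text \<open>With \<open>mult_sq_self\<close>, \<open>?w\<close> equals
  \<open>(x \<or> y) * ?w\<close>, so it is enough to bound \<open>x * ?w\<close> and
  \<open>y * ?w\<close> separately.\<close>

lemma sq_join:
  assumes "x \<in> carrier A" "y \<in> carrier A"
  shows "sq A (x \<^bold>\<or> y) = sq A x \<^bold>\<or> sq A y"
proof (rule le_antisym)
  let ?s = "sq A x \<^bold>\<or> sq A y" and ?w = "sq A (x \<^bold>\<or> y)"
  \<comment> \<open>Every term in the expansion of \<open>sq A (u \<or> v)\<close> except
    \<open>sq A v\<close> contains a factor \<open>u\<close>, so the square lies below
    \<open>u \<or> sq A v\<close>. Multiplying by \<open>u\<close> turns the first summand into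
    \<open>sq A u\<close> and keeps the second below \<open>sq A v\<close>.\<close>
  have le: "u \<^bold>* sq A (u \<^bold>\<or> v) \<^bold>\<le> sq A u \<^bold>\<or> sq A v" if u: "u \<in> carrier A" and v: "v \<in> carrier A" for u v
  proof -
    have "sq A (u \<^bold>\<or> v) \<^bold>\<le> u \<^bold>\<or> sq A v"
    proof -
      have "sq A (u \<^bold>\<or> v) = u \<^bold>* (u \<^bold>\<or> v) \<^bold>\<or> (v \<^bold>* u \<^bold>\<or> sq A v)"
        using u v by (simp add: sq_def join_mult_distrib mult_join_distrib[of v])
      moreover have "u \<^bold>* (u \<^bold>\<or> v) \<^bold>\<le> u \<^bold>\<or> sq A v" "v \<^bold>* u \<^bold>\<le> u \<^bold>\<or> sq A v"
        using u v by (meson le_trans le_join1 mult_le1 mult_le2 mult_closed join_closed sq_closed)+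
      ultimately show ?thesis
        using u v by (simp add: join_le)
    qed
    then have "u \<^bold>* sq A (u \<^bold>\<or> v) \<^bold>\<le> u \<^bold>* (u \<^bold>\<or> sq A v)"
      using u v by (simp add: mult_mono)
    moreover have "u \<^bold>* (u \<^bold>\<or> sq A v) = sq A u \<^bold>\<or> u \<^bold>* sq A v"
      using u v by (simp add: mult_join_distrib sq_def[of A u])
    moreover have "sq A u \<^bold>\<or> u \<^bold>* sq A v \<^bold>\<le> sq A u \<^bold>\<or> sq A v"
    proof (rule join_le)
      show "u \<^bold>* sq A v \<^bold>\<le> sq A u \<^bold>\<or> sq A v"
        using u v by (meson le_trans le_join2 mult_le2 mult_closed join_closed sq_closed)
    qed (use u v in auto)
    ultimately show ?thesis
      using u v by (metis le_trans mult_closed join_closed sq_closed)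
  qed
  have "x \<^bold>* ?w \<^bold>\<le> ?s" "y \<^bold>* ?w \<^bold>\<le> ?s"
    using assms le[of x y] le[of y x] by (simp_all add: join_comm)
  then have "(x \<^bold>\<or> y) \<^bold>* ?w \<^bold>\<le> ?s"
    using assms by (simp add: join_mult_distrib join_le)
  then show "?w \<^bold>\<le> ?s"
    using assms by (simp add: mult_sq_self)
  show "?s \<^bold>\<le> sq A (x \<^bold>\<or> y)"
    using assms by (simp add: join_le sq_mono)
qed (use assms in auto)

text \<open>The right side is the first component of the twist implication between the pairs of
  \<open>x\<close> and \<open>y\<close>, because the meet of idempotents is their product. The upper
  bound uses contraposition for the second factor; the lower bound is the Nelson identity.\<close>

lemma sq_imp:
  assumes "x \<in> carrier A" "y \<in> carrier A"
  shows "sq A (x \<^bold>\<rightarrow> y) =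
    sq A (sq A x \<^bold>\<rightarrow> sq A y) \<^bold>* sq A (sq A (lneg A y) \<^bold>\<rightarrow> sq A (lneg A x))" (is "_ = ?p \<^bold>* ?q")
proof (rule le_antisym)
  have le: "sq A (u \<^bold>\<rightarrow> v) \<^bold>\<le> sq A (sq A u \<^bold>\<rightarrow> sq A v)" if "u \<in> carrier A" "v \<in> carrier A" for u v
  proof -
    have "sq A (u \<^bold>\<rightarrow> v) \<^bold>* sq A u \<^bold>\<le> sq A v"
      using that by (simp add: sq_mult[symmetric] sq_mono imp_mult_le)
    then show ?thesis
      using that by (intro idem_le_sq) (simp_all add: residuation)
  qed
  show "sq A (x \<^bold>\<rightarrow> y) \<^bold>\<le> ?p \<^bold>* ?q"
    using assms le[of x y] le[of "lneg A y" "lneg A x"]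
    by (intro idem_le_mult) (simp_all add: contraposition)
  have "?p \<^bold>* ?q \<^bold>\<le> sq A x \<^bold>\<rightarrow> sq A y" "?p \<^bold>* ?q \<^bold>\<le> sq A (lneg A y) \<^bold>\<rightarrow> sq A (lneg A x)"
    using assms by (meson le_trans mult_le1 mult_le2 sq_le sq_closed imp_closed mult_closed
        lneg_closed)+
  \<comment> \<open>Dropping the squares in the consequents only enlarges the implications and
    produces the two premises of the Nelson identity.\<close>
  then have "?p \<^bold>* ?q \<^bold>\<le> sq A x \<^bold>\<rightarrow> y" "?p \<^bold>* ?q \<^bold>\<le> sq A (lneg A y) \<^bold>\<rightarrow> lneg A x"
    using assms by (auto elim!: le_imp_trans)
  then have "?p \<^bold>* ?q \<^bold>\<le> (sq A x \<^bold>\<rightarrow> y) \<^bold>\<and> (sq A (lneg A y) \<^bold>\<rightarrow> lneg A x)"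
    using assms by (simp add: le_meet)
  from le_trans[OF this nelson_imp_le] have "?p \<^bold>* ?q \<^bold>\<le> x \<^bold>\<rightarrow> y"
    using assms by simp
  then show "?p \<^bold>* ?q \<^bold>\<le> sq A (x \<^bold>\<rightarrow> y)"
    using assms by (intro idem_le_sq) (simp_all add: sq_mult)
qed (use assms in auto)

section \<open>Recovering an element from its square and the square of its negation\<close>

lemma sq_pair_inj:
  assumes "sq A x = sq A y" "sq A (lneg A x) = sq A (lneg A y)" "x \<in> carrier A" "y \<in> carrier A"
  shows "x = y"
  using assms nelson_le[of x y] nelson_le[of y x] sq_le[of x] sq_le[of y]
    sq_le[of "lneg A x"] sq_le[of "lneg A y"]
  by (auto intro: le_antisym)

text \<open>The negation of \<open>a \<or> lneg A a\<close> is \<open>lneg A a \<and> a\<close>,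
  whose square is \<bottom>. Conversely, if the square of \<open>lneg A c\<close> is \<bottom>, then
  \<open>c\<close> and \<open>c \<or> lneg A c\<close> have the same square.\<close>

lemma star_filter_iff:
  "f \<in> star_filter A \<longleftrightarrow> (\<exists>c\<in>carrier A. sq A c = f \<and> sq A (lneg A c) = \<^bold>\<bottom>)"
proof
  assume "f \<in> star_filter A"
  then obtain a where a: "a \<in> carrier A" "f = sq A (a \<^bold>\<or> lneg A a)"
    by (auto simp: star_filter_def)
  have "sq A (lneg A (a \<^bold>\<or> lneg A a)) = \<^bold>\<bottom>"
    using a(1) by (simp add: lneg_join involutive meet_comm sq_meet_lneg)
  with a show "\<exists>c\<in>carrier A. sq A c = f \<and> sq A (lneg A c) = \<^bold>\<bottom>"
    by auto
next
  assume "\<exists>c\<in>carrier A. sq A c = f \<and> sq A (lneg A c) = \<^bold>\<bottom>"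
  then obtain c where "c \<in> carrier A" "sq A c = f" "sq A (lneg A c) = \<^bold>\<bottom>" by blast
  then have "c \<in> carrier A" "f = sq A (c \<^bold>\<or> lneg A c)"
    by (simp_all add: sq_join) (metis join_bot sq_closed)
  then show "f \<in> star_filter A"
    unfolding star_filter_def by blast
qed

lemma sq_pair_surj:
  assumes x: "x \<in> carrier A" "sq A x = x" and y: "y \<in> carrier A" "sq A y = y"
    and disj: "x \<^bold>* y = \<^bold>\<bottom>" and F: "x \<^bold>\<or> y \<in> star_filter A"
  obtains a where "a \<in> carrier A" "sq A a = x" "sq A (lneg A a) = y"
proof -
  obtain c where c: "c \<in> carrier A" "sq A c = x \<^bold>\<or> y" "sq A (lneg A c) = \<^bold>\<bottom>"
    using F unfolding star_filter_iff by blast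
  \<comment> \<open>Disjointness puts \<open>x\<close> below \<open>lneg A y\<close>, and an
    idempotent below an element is below its square.\<close>
  have "x \<^bold>\<le> sq A (lneg A y)"
    using x y disj by (simp add: idem_le_sq mult_eq_bot_iff)
  then have xy: "sq A (lneg A y) \<^bold>* x = x"
    using x y by (metis idem_mult_eq_iff mult_comm sq_closed lneg_closed)
  have "sq A (lneg A y) \<^bold>* y \<^bold>\<le> lneg A y \<^bold>* y"
    using y by (simp add: mult_mono1)
  then have yy: "sq A (lneg A y) \<^bold>* y = \<^bold>\<bottom>"
    using y by (simp add: mult_comm[of "lneg A y"] mult_lneg le_bot_iff)
  show ?thesis
  \<comment> \<open>The meet with \<open>lneg A y\<close> cuts the summand \<open>y\<close> out of
    \<open>sq A c = x \<or> y\<close> and leaves \<open>x\<close>. The negation is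
    \<open>y \<or> lneg A c\<close>, whose square is \<open>y\<close> because
    \<open>lneg A c\<close> squares to \<bottom>.\<close>
  proof (rule that[of "lneg A y \<^bold>\<and> c"])
    show "sq A (lneg A y \<^bold>\<and> c) = x"
      using x y c xy yy by (simp add: sq_meet mult_join_distrib)
    show "sq A (lneg A (lneg A y \<^bold>\<and> c)) = y"
      using y c by (simp add: lneg_meet involutive sq_join)
  qed (use y c in auto)
qed

end

section \<open>The modal Heyting algebra of idempotents\<close>

context mn_lattice
begin

lemmas modal_closed [simp, intro] = nbox_closed ndia_closed

lemma star_simps:
  "carrier (star_mh N) = {a \<in> carrier N. sq N a = a}"
  "ltop (star_mh N) = \<^bold>\<top>" "lbot (star_mh N) = \<^bold>\<bottom>"
  "box (star_mh N) x = sq N (nbox N x)" "dia (star_mh N) x = sq N (ndia N x)"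
  by (simp_all add: star_mh_def)

lemma star_ops:
  assumes "x \<in> carrier N" "sq N x = x" "y \<in> carrier N" "sq N y = y"
  shows "x \<^bold>\<and>\<^bsub>star_mh N\<^esub> y = x \<^bold>* y" "x \<^bold>\<or>\<^bsub>star_mh N\<^esub> y = x \<^bold>\<or> y"
    "x \<^bold>\<rightarrow>\<^bsub>star_mh N\<^esub> y = sq N (x \<^bold>\<rightarrow> y)"
  using assms by (simp_all add: star_mh_def sq_meet sq_join)

text \<open>The star meet is the product, and for idempotent \<open>x\<close> the equation
  \<open>x * y = x\<close> means \<open>x \<le> y\<close>. The star order is thus inherited from
  \<open>N\<close>.\<close>

lemma star_le:
  "\<lbrakk>x \<in> carrier N; sq N x = x; y \<in> carrier N; sq N y = y\<rbrakk> \<Longrightarrow> x \<^bold>\<le>\<^bsub>star_mh N\<^esub> y \<longleftrightarrow> x \<^bold>\<le> y"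
  by (simp add: lle_def[of "star_mh N"] star_ops idem_mult_eq_iff)

lemma star_lneg: "\<lbrakk>x \<in> carrier N; sq N x = x\<rbrakk> \<Longrightarrow> lneg (star_mh N) x = sq N (lneg N x)"
  by (simp add: lneg_def star_simps star_ops)

lemma idem_mult: "\<lbrakk>x \<in> carrier N; sq N x = x; y \<in> carrier N; sq N y = y\<rbrakk> \<Longrightarrow> sq N (x \<^bold>* y) = x \<^bold>* y"
  by (simp add: sq_mult)

lemma idem_join: "\<lbrakk>x \<in> carrier N; sq N x = x; y \<in> carrier N; sq N y = y\<rbrakk> \<Longrightarrow> sq N (x \<^bold>\<or> y) = x \<^bold>\<or> y"
  by (simp add: sq_join)

text \<open>An element and its square have the same square, so \<open>mN2_box\<close> applies. This
  makes the first component of the pair compatible with the box.\<close>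

lemma sq_nbox_sq: "x \<in> carrier N \<Longrightarrow> sq N (nbox N (sq N x)) = sq N (nbox N x)"
  by (simp add: mN2_box[of "sq N x" x])

lemma sq_ndia_sq: "x \<in> carrier N \<Longrightarrow> sq N (ndia N (sq N x)) = sq N (ndia N x)"
  by (simp add: mN2_dia[of "sq N x" x])

lemma lneg_nbox: "x \<in> carrier N \<Longrightarrow> lneg N (nbox N x) = ndia N (lneg N x)"
  by (simp add: mN1 involutive)

lemma lneg_ndia: "x \<in> carrier N \<Longrightarrow> lneg N (ndia N x) = nbox N (lneg N x)"
  by (simp add: mN1 involutive)

lemma heyting_algebra_star: "heyting_algebra (star_mh N)"
proof
  fix x y z
  assume "x \<in> carrier (star_mh N)" "y \<in> carrier (star_mh N)" "z \<in> carrier (star_mh N)"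
  then have xyz: "x \<in> carrier N" "sq N x = x" "y \<in> carrier N" "sq N y = y" "z \<in> carrier N" "sq N z = z"
    by (simp_all add: star_simps)
  \<comment> \<open>Residuation in \<open>N\<close>; the square is harmless because \<open>x\<close>
    is idempotent.\<close>
  have "x \<^bold>* y \<^bold>\<le> z \<longleftrightarrow> x \<^bold>\<le> sq N (y \<^bold>\<rightarrow> z)"
    using xyz by (metis residuation idem_le_sq sq_le le_trans sq_closed imp_closed)
  then show "x \<^bold>\<and>\<^bsub>star_mh N\<^esub> y \<^bold>\<le>\<^bsub>star_mh N\<^esub> z \<longleftrightarrow> x \<^bold>\<le>\<^bsub>star_mh N\<^esub> y \<^bold>\<rightarrow>\<^bsub>star_mh N\<^esub> z"
    using xyz by (simp add: star_ops star_le idem_mult)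
  show "(x \<^bold>\<and>\<^bsub>star_mh N\<^esub> y) \<^bold>\<and>\<^bsub>star_mh N\<^esub> z = x \<^bold>\<and>\<^bsub>star_mh N\<^esub> (y \<^bold>\<and>\<^bsub>star_mh N\<^esub> z)"
    using xyz by (simp add: star_ops idem_mult mult_assoc)
  show "(x \<^bold>\<or>\<^bsub>star_mh N\<^esub> y) \<^bold>\<or>\<^bsub>star_mh N\<^esub> z = x \<^bold>\<or>\<^bsub>star_mh N\<^esub> (y \<^bold>\<or>\<^bsub>star_mh N\<^esub> z)"
    using xyz by (simp add: star_ops idem_join join_assoc)
next
  fix x y
  assume "x \<in> carrier (star_mh N)" "y \<in> carrier (star_mh N)"
  then have xy: "x \<in> carrier N" "sq N x = x" "y \<in> carrier N" "sq N y = y"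
    by (simp_all add: star_simps)
  show "x \<^bold>\<and>\<^bsub>star_mh N\<^esub> y = y \<^bold>\<and>\<^bsub>star_mh N\<^esub> x"
    using xy by (simp add: star_ops mult_comm)
  show "x \<^bold>\<or>\<^bsub>star_mh N\<^esub> y = y \<^bold>\<or>\<^bsub>star_mh N\<^esub> x"
    using xy by (simp add: star_ops join_comm)
  show "x \<^bold>\<and>\<^bsub>star_mh N\<^esub> (x \<^bold>\<or>\<^bsub>star_mh N\<^esub> y) = x"
    using xy by (simp add: star_ops idem_join idem_mult_eq_iff)
  show "x \<^bold>\<or>\<^bsub>star_mh N\<^esub> (x \<^bold>\<and>\<^bsub>star_mh N\<^esub> y) = x"
    using xy by (simp add: star_ops idem_mult) (metis join_comm le_iff_join mult_closed mult_le1)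
  show "x \<^bold>\<and>\<^bsub>star_mh N\<^esub> y \<in> carrier (star_mh N)" "x \<^bold>\<or>\<^bsub>star_mh N\<^esub> y \<in> carrier (star_mh N)"
    "x \<^bold>\<rightarrow>\<^bsub>star_mh N\<^esub> y \<in> carrier (star_mh N)"
    using xy by (simp_all add: star_ops star_simps idem_mult idem_join)
next
  fix x
  assume "x \<in> carrier (star_mh N)"
  then show "\<^bold>\<bottom>\<^bsub>star_mh N\<^esub> \<^bold>\<le>\<^bsub>star_mh N\<^esub> x" "x \<^bold>\<le>\<^bsub>star_mh N\<^esub> \<^bold>\<top>\<^bsub>star_mh N\<^esub>"
    by (simp_all add: star_simps star_le bot_least top_greatest)
qed (simp_all add: star_simps)

lemma modal_heyting_algebra_star: "modal_heyting_algebra (star_mh N)"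
proof -
  interpret H: heyting_algebra "star_mh N"
    by (rule heyting_algebra_star)
  show ?thesis
  proof
    fix x y
    assume "x \<in> carrier (star_mh N)" "y \<in> carrier (star_mh N)"
    then have xy: "x \<in> carrier N" "sq N x = x" "y \<in> carrier N" "sq N y = y"
      by (simp_all add: star_simps)
    have meet: "lneg (star_mh N) x \<^bold>\<and>\<^bsub>star_mh N\<^esub> y = sq N (lneg N x \<^bold>\<and> y)"
      using xy by (simp add: star_lneg star_ops sq_meet)
    \<comment> \<open>\<open>sq_ndia_sq\<close> removes the square under the diamond, and
      \<open>x = sq N x\<close> brings the negation into the form required by
      \<open>mN3\<close>.\<close>
    have "box (star_mh N) x \<^bold>\<and>\<^bsub>star_mh N\<^esub> dia (star_mh N) (lneg (star_mh N) x \<^bold>\<and>\<^bsub>star_mh N\<^esub> y)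
        = sq N (nbox N x \<^bold>\<and> ndia N (lneg N (sq N x) \<^bold>\<and> y))"
      unfolding meet using xy
      by (simp add: star_simps star_ops sq_ndia_sq sq_meet[of "nbox N x"])
    also have "\<dots> = \<^bold>\<bottom>\<^bsub>star_mh N\<^esub>"
      using mN3[of x y] xy by (simp add: star_simps)
    finally show "box (star_mh N) x \<^bold>\<and>\<^bsub>star_mh N\<^esub>
        dia (star_mh N) (lneg (star_mh N) x \<^bold>\<and>\<^bsub>star_mh N\<^esub> y) = \<^bold>\<bottom>\<^bsub>star_mh N\<^esub>" .
  qed (simp_all add: star_simps)
qed

section \<open>The filter of squares\<close>

lemma boolean_filter_star: "boolean_filter (star_mh N) (star_filter N)"
  unfolding boolean_filter_def lfilter_def
proof (intro conjI ballI impI)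
  show "star_filter N \<subseteq> carrier (star_mh N)" "star_filter N \<noteq> {}"
    by (auto simp: star_filter_def star_simps)
next
  fix x y
  assume "x \<in> star_filter N" "y \<in> star_filter N"
  then obtain c d where "c \<in> carrier N" "sq N c = x" "sq N (lneg N c) = \<^bold>\<bottom>"
    and "d \<in> carrier N" "sq N d = y" "sq N (lneg N d) = \<^bold>\<bottom>"
    unfolding star_filter_iff by blast
  then show "x \<^bold>\<and>\<^bsub>star_mh N\<^esub> y \<in> star_filter N"
    unfolding star_filter_iff
    \<comment> \<open>The negation of the witness is \<open>lneg N c \<or> lneg N d\<close>, a join
      of two elements with square \<bottom>.\<close>
    by (intro bexI[of _ "c \<^bold>\<and> d"]) (auto simp: star_ops sq_meet lneg_meet sq_join)
next
  fix x y
  assume "x \<in> star_filter N" "y \<in> carrier (star_mh N)" and le: "x \<^bold>\<le>\<^bsub>star_mh N\<^esub> y"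
  then obtain c where c: "c \<in> carrier N" "sq N c = x" "sq N (lneg N c) = \<^bold>\<bottom>"
    and y: "y \<in> carrier N" "sq N y = y"
    unfolding star_filter_iff star_simps by blast
  with le have "x \<^bold>\<or> y = y"
    by (metis star_le le_iff_join sq_closed sq_sq)
  with c y show "y \<in> star_filter N"
    unfolding star_filter_iff
    \<comment> \<open>The witness has square \<open>x \<or> y = y\<close>, and its negation lies
      below \<open>lneg N c\<close>.\<close>
    by (intro bexI[of _ "c \<^bold>\<or> y"]) (auto simp: sq_join lneg_join sq_meet)
next
  fix x
  assume "x \<in> carrier (star_mh N)" and "lneg (star_mh N) (lneg (star_mh N) x) = \<^bold>\<top>\<^bsub>star_mh N\<^esub>"
  then have x: "x \<in> carrier N" "sq N x = x" and "sq N (lneg N (sq N (lneg N x))) = \<^bold>\<top>"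
    by (simp_all add: star_simps star_lneg)
  \<comment> \<open>A square lies below its base, so a square equal to \<top> forces the base to be
    \<top>. Then \<open>lneg N x\<close> squares to \<bottom>, and \<open>x\<close> itself is the
    witness for membership.\<close>
  then have "lneg N (sq N (lneg N x)) = \<^bold>\<top>"
    by (metis sq_le top_le_iff sq_closed lneg_closed)
  then have "sq N (lneg N x) = \<^bold>\<bottom>"
    using x by (metis involutive lneg_top sq_closed lneg_closed)
  with x show "x \<in> star_filter N"
    unfolding star_filter_iff by blast
qed

text \<open>By surjectivity \<open>x\<close> and \<open>y\<close> are the squares of some
  \<open>a\<close> and its negation. As the diamond of \<open>lneg N a\<close> is the negation of
  \<open>nbox N a\<close>, the required join is the generator of the filter given by
  \<open>nbox N a\<close>.\<close>

lemma modal_filter_cond_star: "modal_filter_cond (star_mh N) (star_filter N)"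
  unfolding modal_filter_cond_def
proof (intro ballI impI)
  fix x y
  assume "x \<in> carrier (star_mh N)" "y \<in> carrier (star_mh N)"
    and disj: "x \<^bold>\<and>\<^bsub>star_mh N\<^esub> y = \<^bold>\<bottom>\<^bsub>star_mh N\<^esub> \<and> x \<^bold>\<or>\<^bsub>star_mh N\<^esub> y \<in> star_filter N"
  then have xy: "x \<in> carrier N" "sq N x = x" "y \<in> carrier N" "sq N y = y"
    by (simp_all add: star_simps)
  with disj obtain a where a: "a \<in> carrier N" "sq N a = x" "sq N (lneg N a) = y"
    by (auto simp: star_ops star_simps elim: sq_pair_surj)
  have "box (star_mh N) x \<^bold>\<or>\<^bsub>star_mh N\<^esub> dia (star_mh N) y = sq N (nbox N a \<^bold>\<or> lneg N (nbox N a))"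
    using a by (auto simp: star_simps star_ops sq_nbox_sq sq_ndia_sq sq_join lneg_nbox)
  then show "box (star_mh N) x \<^bold>\<or>\<^bsub>star_mh N\<^esub> dia (star_mh N) y \<in> star_filter N"
    using a by (auto simp: star_filter_def)
qed

section \<open>The isomorphism onto the twist structure\<close>

lemma sq_pair_in_twist_carrier:
  "a \<in> carrier N \<Longrightarrow> (sq N a, sq N (lneg N a)) \<in> twist_carrier (star_mh N) (star_filter N)"
  by (auto simp: twist_carrier_def star_simps star_ops sq_mult[symmetric] mult_lneg
      sq_join[symmetric] star_filter_def)

lemma sq_pair_mn_hom:
  "(\<lambda>a. (sq N a, sq N (lneg N a))) \<in> mn_hom N (twist_mn (star_mh N) (star_filter N))"
  unfolding mn_hom_def mem_Collect_eq
proof (intro conjI ballI)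
  fix a b
  assume ab: "a \<in> carrier N" "b \<in> carrier N"
  show "(sq N (a \<^bold>* b), sq N (lneg N (a \<^bold>* b))) =
      (sq N a, sq N (lneg N a)) \<^bold>*\<^bsub>twist_mn (star_mh N) (star_filter N)\<^esub> (sq N b, sq N (lneg N b))"
    using ab
    \<comment> \<open>The second component comes from \<open>lneg_mult\<close>: the negated product
      is the implication from \<open>a\<close> to \<open>lneg N b\<close>, and \<open>sq_imp\<close>
      splits its square into the two star implications of the twist product.\<close>
    by (simp add: twist_mn_def star_ops sq_mult lneg_mult sq_imp[of a "lneg N b"] involutive)
  show "(sq N (a \<^bold>\<rightarrow> b), sq N (lneg N (a \<^bold>\<rightarrow> b))) =
      (sq N a, sq N (lneg N a)) \<^bold>\<rightarrow>\<^bsub>twist_mn (star_mh N) (star_filter N)\<^esub> (sq N b, sq N (lneg N b))"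
    using ab by (simp add: twist_mn_def star_ops sq_mult lneg_imp sq_imp[of a b])
qed (auto simp: twist_mn_def sq_pair_in_twist_carrier star_ops star_simps sq_meet sq_join
    lneg_meet lneg_join lneg_nbox lneg_ndia sq_nbox_sq sq_ndia_sq)

lemma sq_pair_bij_betw: "bij_betw (\<lambda>a. (sq N a, sq N (lneg N a))) (carrier N)
    (twist_carrier (star_mh N) (star_filter N))"
  unfolding bij_betw_def
proof
  show "inj_on (\<lambda>a. (sq N a, sq N (lneg N a))) (carrier N)"
    by (auto intro: inj_onI sq_pair_inj)
  have "\<exists>a\<in>carrier N. p = (sq N a, sq N (lneg N a))"
    if "p \<in> twist_carrier (star_mh N) (star_filter N)" for p
    using that by (auto simp: twist_carrier_def star_simps star_ops) (metis sq_pair_surj)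
  then show "(\<lambda>a. (sq N a, sq N (lneg N a))) ` carrier N = twist_carrier (star_mh N) (star_filter N)"
    using sq_pair_in_twist_carrier by blast
qed

end

theorem theorem4:
  fixes N :: "'a modal_res_alg"
  assumes "mn_lattice N"
  shows "modal_heyting_algebra (star_mh N)
    \<and> boolean_filter (star_mh N) (star_filter N)
    \<and> modal_filter_cond (star_mh N) (star_filter N)
    \<and> (\<lambda>a. (sq N a, sq N (lneg N a))) \<in> mn_iso N (twist_mn (star_mh N) (star_filter N))"
proof -
  interpret mn_lattice N by fact
  show ?thesis
    using modal_heyting_algebra_star boolean_filter_star modal_filter_cond_star
      sq_pair_mn_hom sq_pair_bij_betw
    by (simp add: mn_iso_def twist_mn_def)
qed

end
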